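(* Let $\nu\ge3$ and $X=Sp(2\nu,2)$. Let $S\subset V(X)$ be a $4$-subset and $X^S$ the switched graph as in the context. Then $X^S$ is isomorphic to the switched graph obtained from $X$ by Godsil–McKay switching with respect to the Godsil–McKay partition $\{S,V(X)\setminus S\}$ with Godsil–McKay cell $V(X)\setminus S$.
   Context: $N(x)$ is the set of neighbors of $x$. Let $R=\begin{bmatrix}0&1\\1&0\end{bmatrix}$ and $K=I_\nu\otimes R$ over $\mathbb{F}_2$. The symplectic graph $Sp(2\nu,2)$ has vertex set $\mathbb{F}_2^{2\nu}\setminus\{\mathbf 0\}$, with $x,y$ adjacent iff $x^TKy=1$. Godsil–McKay switching: a partition $\{C_1,\dots,C_t,D\}$ of $V(X)$ is a Godsil–McKay partition with Godsil–McKay cell $D$ if (i) for all $i,j\in\{1,\dots,t\}$ any two vertices of $C_i$ have the same number of neighbors in $C_j$, and (ii) for every $x\in D$ and every $i\in\{1,\dots,t\}$, $|N(x)\cap C_i|\in\{0,\frac12|C_i|,|C_i|\}$. The switched graph is obtained from $X$ by interchanging adjacency and non-adjacency between $x\in D$ and the vertices of $C_i$ whenever $|N(x)\cap C_i|=\frac12|C_i|$. $S=\{v_1,v_2,v_3,v_4\}$, where $v_1,v_2,v_3$ are linearly independent, $v_i^TKv_j=0$ for all $i,j\in\{1,2,3\}$, and $v_4=v_1+v_2+v_3$. For $i=0,2,4$ let $S_i=\{x\in V(X):\#\{j\in\{1,2,3,4\}:x^TKv_j=1\}=i\}$, and $T=\{v_1+v_2,v_2+v_3,v_3+v_1\}$.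 $X^S$ is the switched graph with respect to the partition $\{S,T,S_0\setminus(S\cup T),S_2,S_4\}$ of $V(X)$ (empty sets discarded) with Godsil–McKay cell $D=S$. *)

theory Defs
  imports
    "HOL-Analysis.Analysis"
    "HOL-Library.Z2"
    "HOL-Library.Disjoint_Sets"
    "Graph_Theory.Graph_Theory"
begin

text \<open>
  Undirected graphs are symmetric loop-free pair digraphs: an edge \<open>xy\<close> is represented by
  the two arcs \<open>(x, y)\<close> and \<open>(y, x)\<close>.
\<close>

definition nbrs :: "'a pair_pre_digraph \<Rightarrow> 'a \<Rightarrow> 'a set" where
  "nbrs X x = {y \<in> pverts X. (x, y) \<in> parcs X}"

text \<open>
  A partition \<open>{C\<^sub>1, \<dots>, C\<^sub>t, D}\<close> is given by the set \<open>\<C> = {C\<^sub>1, \<dots>, C\<^sub>t}\<close> and the distinguished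
  cell \<open>D\<close>. The condition \<open>|N(x) \<inter> C| = |C|/2\<close> is cleared of denominators.
\<close>

definition GM_partition :: "'a pair_pre_digraph \<Rightarrow> 'a set set \<Rightarrow> 'a set \<Rightarrow> bool" where
  "GM_partition X \<C> D \<longleftrightarrow>
     partition_on (pverts X) (insert D \<C>) \<and> D \<notin> \<C> \<and>
     (\<forall>C\<in>\<C>. \<forall>C'\<in>\<C>. \<forall>x\<in>C. \<forall>y\<in>C. card (nbrs X x \<inter> C') = card (nbrs X y \<inter> C')) \<and>
     (\<forall>x\<in>D. \<forall>C\<in>\<C>. card (nbrs X x \<inter> C) = 0 \<or> 2 * card (nbrs X x \<inter> C) = card C \<or>
        card (nbrs X x \<inter> C) = card C)"

definition GM_flip :: "'a pair_pre_digraph \<Rightarrow> 'a set set \<Rightarrow> 'a set \<Rightarrow> 'a \<Rightarrow> 'a \<Rightarrow> bool" where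
  "GM_flip X \<C> D x y \<longleftrightarrow> x \<in> D \<and> (\<exists>C\<in>\<C>. y \<in> C \<and> 2 * card (nbrs X x \<inter> C) = card C)"

definition GM_switch :: "'a pair_pre_digraph \<Rightarrow> 'a set set \<Rightarrow> 'a set \<Rightarrow> 'a pair_pre_digraph" where
  "GM_switch X \<C> D =
     \<lparr>pverts = pverts X,
      parcs = {(x, y) \<in> pverts X \<times> pverts X.
        if GM_flip X \<C> D x y \<or> GM_flip X \<C> D y x then (x, y) \<notin> parcs X else (x, y) \<in> parcs X}\<rparr>"

text \<open>
  The coordinates of \<open>\<bbbF>\<^sub>2\<^bsup>2\<nu>\<^esup>\<close> are indexed by \<open>'n \<times> 2\<close> with \<open>\<nu> = CARD('n)\<close>, the natural index
  type for a Kronecker product of a \<open>\<nu> \<times> \<nu>\<close> and a \<open>2 \<times> 2\<close> matrix.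
\<close>

definition kronecker ::
  "'a::semiring_1 ^ 'c ^ 'r \<Rightarrow> 'a ^ 'd ^ 's \<Rightarrow> 'a ^ ('c \<times> 'd) ^ ('r \<times> 's)" where
  "kronecker A B = (\<chi> p q. A $ fst p $ fst q * B $ snd p $ snd q)"

definition R_mat :: "bit ^ 2 ^ 2" where
  "R_mat = vector [vector [0, 1], vector [1, 0]]"

definition K_mat :: "bit ^ ('n::finite \<times> 2) ^ ('n \<times> 2)" where
  "K_mat = kronecker (mat 1) R_mat"

definition sympl_form :: "bit ^ ('n::finite \<times> 2) \<Rightarrow> bit ^ ('n \<times> 2) \<Rightarrow> bit" where
  "sympl_form x y = scalar_product x (K_mat *v y)"

definition Sp :: "(bit ^ ('n::finite \<times> 2)) pair_pre_digraph" where
  "Sp = \<lparr>pverts = UNIV - {0},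
         parcs = {(x, y). x \<noteq> 0 \<and> y \<noteq> 0 \<and> sympl_form x y = 1}\<rparr>"

text \<open>
  The vectors \<open>v\<^sub>1, v\<^sub>2, v\<^sub>3, v\<^sub>4\<close> are the values at \<open>1, 2, 3, 4\<close> of a function \<open>v\<close> on the natural
  numbers; its other values play no role.
\<close>

definition S_set :: "(nat \<Rightarrow> bit ^ ('n::finite \<times> 2)) \<Rightarrow> (bit ^ ('n \<times> 2)) set" where
  "S_set v = v ` {1..4}"

definition S_level :: "(nat \<Rightarrow> bit ^ ('n::finite \<times> 2)) \<Rightarrow> nat \<Rightarrow> (bit ^ ('n \<times> 2)) set" where
  "S_level v i = {x \<in> pverts Sp. card {j \<in> {1..4}. sympl_form x (v j) = 1} = i}"

definition T_set :: "(nat \<Rightarrow> bit ^ ('n::finite \<times> 2)) \<Rightarrow> (bit ^ ('n \<times> 2)) set" where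
  "T_set v = {v 1 + v 2, v 2 + v 3, v 3 + v 1}"

definition Sp_switched :: "(nat \<Rightarrow> bit ^ ('n::finite \<times> 2)) \<Rightarrow> (bit ^ ('n \<times> 2)) pair_pre_digraph"
  where
  "Sp_switched v =
     GM_switch Sp
       ({T_set v, S_level v 0 - (S_set v \<union> T_set v), S_level v 2, S_level v 4} - {{}})
       (S_set v)"

end

theory Submission
  imports Defs
begin

text \<open>
  The two switched graphs are in fact equal, so the identity is an isomorphism.

  Since \<open>v\<^sub>1 + v\<^sub>2 + v\<^sub>3 + v\<^sub>4 = 0\<close>, every vertex \<open>x\<close> is adjacent to an even number of the four
  vectors of \<open>S\<close>, i.e. lies in exactly one of \<open>S\<^sub>0\<close>, \<open>S\<^sub>2\<close>, \<open>S\<^sub>4\<close>. This makes \<open>{S, V - S}\<close> a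
  Godsil--McKay partition with Godsil--McKay cell \<open>V - S\<close>, and switching with respect to it
  changes exactly the pairs between \<open>S\<close> and \<open>S\<^sub>2\<close>.

  In the other switching the Godsil--McKay cell is \<open>S\<close>. A vector of \<open>S\<close> is adjacent to no
  vertex of \<open>T\<close> or \<open>S\<^sub>0\<close> and to every vertex of \<open>S\<^sub>4\<close>, so these cells cause no change. But it
  is adjacent to exactly half of \<open>S\<^sub>2\<close>: because the symplectic form is nondegenerate and
  \<open>v\<^sub>1, v\<^sub>2, v\<^sub>3\<close> are independent, there is a vector \<open>u\<close> whose form with each \<open>v\<^sub>i\<close> is \<open>1\<close>,
  and translation by \<open>u\<close> permutes \<open>S\<^sub>2\<close> while exchanging neighbours and non-neighbours of
  every \<open>v\<^sub>i\<close>. Hence this switching, too, changes exactly the pairs between \<open>S\<close> and \<open>S\<^sub>2\<close>.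
\<close>

text \<open>
  The library would rewrite a sum in \<open>\<bbbF>\<^sub>2\<close> to an exclusive or of bits, to which the ring laws
  used below do not apply.
\<close>

declare add_bit_eq_xor [simp del] mult_bit_eq_and [simp del]

lemma bit_0_or_1: "(b :: bit) = 0 \<or> b = 1"
  by (cases b) auto

instance bit :: finite
proof
  have "(UNIV :: bit set) = {0, 1}"
    using bit_0_or_1 by auto
  then show "finite (UNIV :: bit set)"
    by (metis finite.emptyI finite_insert)
qed

section \<open>The symplectic form\<close>

lemma R_mat_entries:
  "R_mat $ 1 $ 1 = 0" "R_mat $ 1 $ 2 = 1" "R_mat $ 2 $ 1 = 1" "R_mat $ 2 $ 2 = 0"
  unfolding R_mat_def vector_2 by (rule refl)+

lemma R_mat_nth: "R_mat $ a $ b = (if b = a + 1 then 1 else 0)"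
  by (rule exhaust_2[of a, THEN disjE]; rule exhaust_2[of b, THEN disjE];
      simp add: R_mat_entries)

text \<open>
  Multiplication by \<open>K\<close> exchanges the two coordinates in each block; adding \<open>1\<close> exchanges the
  two elements of the index type \<open>2\<close>.
\<close>

lemma K_mat_nth: "K_mat $ p $ q = (if q = (fst p, snd p + 1) then 1 else 0)"
  by (simp add: K_mat_def kronecker_def mat_def R_mat_nth prod_eq_iff)

lemma sympl_form_eq_sum:
  "sympl_form x y = (\<Sum>p\<in>UNIV. x $ p * y $ (fst p, snd p + 1))"
  by (simp add: sympl_form_def scalar_product_def matrix_vector_mult_def K_mat_nth
      if_distrib[of "\<lambda>c. c * _"] cong: if_cong)

lemma index_2_add_1_add_1: "(k :: 2) + 1 + 1 = k"
  using exhaust_2[of k] by auto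

lemma sum_swap_blocks:
  "(\<Sum>p\<in>UNIV. f (fst p, snd p + 1)) = (\<Sum>p\<in>(UNIV :: ('n::finite \<times> 2) set). f p)"
  by (rule sum.reindex_bij_witness[of _ "\<lambda>p. (fst p, snd p + 1)" "\<lambda>p. (fst p, snd p + 1)"])
     (auto simp: index_2_add_1_add_1)

lemma sympl_form_commute: "sympl_form x y = sympl_form y x"
  unfolding sympl_form_eq_sum
  by (subst sum_swap_blocks[symmetric]) (simp add: index_2_add_1_add_1 mult.commute)

lemma sympl_form_add_left: "sympl_form (x + y) z = sympl_form x z + sympl_form y z"
  by (simp add: sympl_form_eq_sum distrib_right sum.distrib)

lemma sympl_form_add_right: "sympl_form x (y + z) = sympl_form x y + sympl_form x z"
  by (simp add: sympl_form_eq_sum distrib_left sum.distrib)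

lemma sympl_form_0_left: "sympl_form 0 x = 0"
  by (simp add: sympl_form_eq_sum)

text \<open>
  Nondegeneracy: a function on an independent set extends to a linear functional, and every
  linear functional is the form with a fixed vector, namely with \<open>K w\<close> where \<open>w\<close> is the
  coefficient vector of the functional.
\<close>

lemma sympl_form_prescribed_on_independent:
  fixes B :: "(bit ^ ('n::finite \<times> 2)) set" and g :: "bit ^ ('n \<times> 2) \<Rightarrow> bit"
  assumes "vec.independent B"
  shows "\<exists>u. \<forall>y\<in>B. sympl_form u y = g y"
proof -
  obtain f :: "bit ^ ('n \<times> 2) \<Rightarrow> bit ^ 1"
    where f: "Vector_Spaces.linear (*s) (*s) f" "\<forall>y\<in>B. f y = (\<chi> _. g y)"
    using vec.linear_independent_extend[OF assms, of "\<lambda>y. \<chi> _. g y"] by blast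
  let ?w = "matrix f $ 1"
  let ?u = "\<chi> p. ?w $ (fst p, snd p + 1)"
  have "sympl_form ?u y = f y $ 1" for y
  proof -
    have "sympl_form ?u y = (\<Sum>p\<in>UNIV. ?w $ p * y $ p)"
      by (simp add: sympl_form_eq_sum sum_swap_blocks[of "\<lambda>p. ?w $ p * y $ p"])
    also have "\<dots> = f y $ 1"
      by (simp flip: matrix_works[OF f(1)] add: matrix_vector_mult_def)
    finally show ?thesis .
  qed
  with f(2) show ?thesis
    by (intro exI[of _ ?u]) auto
qed

section \<open>Switched graphs as plain digraphs\<close>

lemma digraph_iso_refl:
  assumes "wf_digraph G"
  shows "digraph_iso G G"
proof -
  let ?f = "\<lparr>iso_verts = id, iso_arcs = id, iso_head = head G, iso_tail = tail G\<rparr>"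
  have "pre_digraph.digraph_isomorphism G ?f"
    using assms by (simp add: pre_digraph.digraph_isomorphism_def)
  moreover have "G = app_iso ?f G"
    by (simp add: app_iso_def)
  ultimately show ?thesis
    unfolding digraph_iso_def by blast
qed

lemma wf_digraph_GM_switch: "wf_digraph (with_proj (GM_switch X \<C> D))"
  by unfold_locales (auto simp: GM_switch_def split: if_splits)

lemma nbrs_Sp: "x \<noteq> 0 \<Longrightarrow> nbrs Sp x = {y. y \<noteq> 0 \<and> sympl_form x y = 1}"
  by (auto simp: nbrs_def Sp_def)

section \<open>Isotropic quadruples with sum zero\<close>

locale isotropic_quadruple =
  fixes v :: "nat \<Rightarrow> bit ^ ('n::finite \<times> 2)"
  assumes nonzero: "S_set v \<subseteq> pverts Sp"
    and card_S: "card (S_set v) = 4"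
    and inj3: "inj_on v {1..3}"
    and independent: "vec.independent (v ` {1..3})"
    and isotropic: "\<forall>i\<in>{1..3}. \<forall>j\<in>{1..3}. sympl_form (v i) (v j) = 0"
    and v4: "v 4 = v 1 + v 2 + v 3"
begin

lemma four: "{1..4} = {1, 2, 3, 4 :: nat}"
  by auto

lemma S_eq: "S_set v = {v 1, v 2, v 3, v 4}"
  unfolding S_set_def four by simp

lemma inj_v: "inj_on v {1..4}"
  using card_S by (intro eq_card_imp_inj_on) (auto simp: S_set_def)

lemma form_v4: "sympl_form x (v 4) = sympl_form x (v 1) + sympl_form x (v 2) + sympl_form x (v 3)"
  by (simp add: v4 sympl_form_add_right)

lemma orthogonal: "a \<in> S_set v \<Longrightarrow> b \<in> S_set v \<Longrightarrow> sympl_form a b = 0"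
proof -
  have "sympl_form (v i) (v j) = 0" if "i \<in> {1, 2, 3}" "j \<in> {1, 2, 3}" for i j
    using isotropic that by auto
  then show "a \<in> S_set v \<Longrightarrow> b \<in> S_set v \<Longrightarrow> sympl_form a b = 0"
    by (auto simp: S_eq v4 sympl_form_add_right sympl_form_add_left)
qed

lemma S_nonzero: "a \<in> S_set v \<Longrightarrow> a \<noteq> 0"
  using nonzero by (auto simp: Sp_def)

text \<open>
  The number of \<open>v\<^sub>j\<close> adjacent to \<open>x\<close> is even, as it is congruent modulo \<open>2\<close> to the form of
  \<open>x\<close> with the sum of the four vectors.
\<close>

lemma level_cases:
  "card {j \<in> {1..4}. sympl_form x (v j) = 1} \<in> {0, 2, 4}"
proof -
  have "{j \<in> {1..4}. sympl_form x (v j) = 1} =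
    (if sympl_form x (v 1) = 1 then {1} else {}) \<union> (if sympl_form x (v 2) = 1 then {2} else {}) \<union>
    (if sympl_form x (v 3) = 1 then {3} else {}) \<union> (if sympl_form x (v 4) = 1 then {4} else {})"
    unfolding four by auto
  then show ?thesis
    using bit_0_or_1[of "sympl_form x (v 1)"] bit_0_or_1[of "sympl_form x (v 2)"]
      bit_0_or_1[of "sympl_form x (v 3)"]
    by (auto simp: form_v4)
qed

lemma card_nbrs_S:
  assumes "x \<noteq> 0"
  shows "card (nbrs Sp x \<inter> S_set v) = card {j \<in> {1..4}. sympl_form x (v j) = 1}"
proof -
  have "nbrs Sp x \<inter> S_set v = v ` {j \<in> {1..4}. sympl_form x (v j) = 1}"
    using assms S_nonzero by (auto simp: nbrs_Sp S_set_def)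
  moreover have "inj_on v {j \<in> {1..4}. sympl_form x (v j) = 1}"
    by (rule inj_on_subset[OF inj_v]) auto
  ultimately show ?thesis
    by (simp only: card_image)
qed

lemma level_nonzero: "x \<in> S_level v i \<Longrightarrow> x \<noteq> 0"
  by (simp add: S_level_def Sp_def)

lemma level_unique: "x \<in> S_level v i \<Longrightarrow> x \<in> S_level v j \<Longrightarrow> i = j"
  unfolding S_level_def by blast

lemma level_0: "x \<in> S_level v 0 \<longleftrightarrow> x \<noteq> 0 \<and> (\<forall>a\<in>S_set v. sympl_form x a \<noteq> 1)"
  by (auto simp: S_level_def Sp_def S_set_def)

lemma level_4: "x \<in> S_level v 4 \<longleftrightarrow> x \<noteq> 0 \<and> (\<forall>a\<in>S_set v. sympl_form x a = 1)"
proof -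
  have "card {j \<in> {1..4}. sympl_form x (v j) = 1} = 4 \<longleftrightarrow>
      {j \<in> {1..4}. sympl_form x (v j) = 1} = {1..4}"
    (is "card ?J = 4 \<longleftrightarrow> _")
  proof
    assume "card ?J = 4"
    then have "card ?J = card {1..4 :: nat}"
      by simp
    then show "?J = {1..4}"
      by (intro card_subset_eq) auto
  next
    assume "?J = {1..4}"
    then show "card ?J = 4"
      by (simp only: card_atLeastAtMost)
  qed
  also have "\<dots> \<longleftrightarrow> (\<forall>a\<in>S_set v. sympl_form x a = 1)"
    unfolding S_set_def by blast
  finally show ?thesis
    by (simp add: S_level_def Sp_def)
qed

lemma S_subset_level_0: "S_set v \<subseteq> S_level v 0"
  using orthogonal S_nonzero by (auto simp: level_0)

lemma exists_common_neighbour: "\<exists>u. \<forall>a\<in>S_set v. sympl_form u a = 1"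
proof -
  obtain u where "\<forall>y\<in>v ` {1..3}. sympl_form u y = 1"
    using sympl_form_prescribed_on_independent[OF independent, of "\<lambda>_. 1"] by blast
  then have "sympl_form u (v 1) = 1" "sympl_form u (v 2) = 1" "sympl_form u (v 3) = 1"
    by auto
  then show ?thesis
    by (intro exI[of _ u]) (simp add: S_eq form_v4)
qed

text \<open>
  Translation by a common neighbour \<open>u\<close> of \<open>S\<close> replaces the set of indices \<open>j\<close> with \<open>x\<close>
  adjacent to \<open>v\<^sub>j\<close> by its complement, so it maps the two-element sets to two-element sets and
  exchanges the two parts of \<open>S\<^sub>2\<close> determined by any \<open>a \<in> S\<close>.
\<close>

lemma half_of_level_2:
  assumes a: "a \<in> S_set v"
  shows "2 * card (nbrs Sp a \<inter> S_level v 2) = card (S_level v 2)"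
proof -
  obtain u where u: "\<And>b. b \<in> S_set v \<Longrightarrow> sympl_form u b = 1"
    using exists_common_neighbour by blast
  let ?J = "\<lambda>x. {j \<in> {1..4}. sympl_form x (v j) = 1}"
  let ?P = "{x \<in> S_level v 2. sympl_form x a = 1}"
  let ?N = "{x \<in> S_level v 2. sympl_form x a \<noteq> 1}"
  have flip: "sympl_form (x + u) b = 1 \<longleftrightarrow> sympl_form x b \<noteq> 1" if "b \<in> S_set v" for x b
    using bit_0_or_1[of "sympl_form x b"] u[OF that] by (auto simp: sympl_form_add_left)
  have shift: "x + u \<in> S_level v 2" if "x \<in> S_level v 2" for x
  proof -
    have "?J (x + u) = {1..4} - ?J x"
      using flip by (auto simp: S_set_def)
    also have "card \<dots> = card {1..4 :: nat} - card (?J x)"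
      by (rule card_Diff_subset) auto
    finally have "card (?J (x + u)) = 4 - card (?J x)"
      by simp
    then have card2: "card (?J (x + u)) = 2"
      using that by (simp add: S_level_def)
    moreover have "x + u \<noteq> 0"
    proof
      assume "x + u = 0"
      with card2 show False
        by (simp add: sympl_form_0_left)
    qed
    ultimately show ?thesis
      by (simp add: S_level_def Sp_def)
  qed
  have "u + u = 0"
    by (simp add: vec_eq_iff)
  then have twice: "x + u + u = x" for x
    by (simp add: add.assoc)
  have "bij_betw (\<lambda>x. x + u) ?P ?N"
    by (rule bij_betwI[where g = "\<lambda>x. x + u"]) (auto simp: shift flip[OF a] twice simp del: bit_not_one_iff)
  then have "card ?P = card ?N"
    by (rule bij_betw_same_card)
  moreover have "card (S_level v 2) = card ?P + card ?N"
    by (subst card_Un_disjoint[symmetric]) (auto intro: arg_cong[of _ _ card])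
  moreover have "nbrs Sp a \<inter> S_level v 2 = ?P"
    using S_nonzero[OF a] by (auto simp: nbrs_Sp sympl_form_commute[of a] sympl_form_0_left
        level_nonzero)
  ultimately show ?thesis
    by simp
qed

lemma T_subset_level_0: "T_set v \<subseteq> S_level v 0"
proof
  fix x
  assume "x \<in> T_set v"
  then obtain i j where ij: "x = v i + v j" "i \<in> {1..3}" "j \<in> {1..3}" "i \<noteq> j"
    by (auto simp: T_set_def)
  have "v i \<noteq> v j"
    using ij inj3 by (auto dest: inj_onD)
  moreover have "v j + v j = 0"
    by (simp add: vec_eq_iff)
  ultimately have "v i + v j \<noteq> 0"
    by (metis add_right_cancel)
  moreover have "sympl_form x a = 0" if "a \<in> S_set v" for a
    using orthogonal[OF _ that] ij by (auto simp: sympl_form_add_left S_set_def)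
  ultimately show "x \<in> S_level v 0"
    using ij by (simp add: level_0)
qed

section \<open>Both switchings change the same pairs\<close>

text \<open>
  A cell with all or none of its vertices adjacent to \<open>a \<in> S\<close> could meet the condition
  \<open>|N(a) \<inter> C| = |C|/2\<close> only if it were empty, and empty cells have been discarded.
\<close>

lemma flip_of_cell_S:
  "GM_flip Sp ({T_set v, S_level v 0 - (S_set v \<union> T_set v), S_level v 2, S_level v 4} - {{}})
     (S_set v) x y \<longleftrightarrow> x \<in> S_set v \<and> y \<in> S_level v 2"
proof -
  have none: "2 * card (nbrs Sp a \<inter> C) \<noteq> card C"
    if "a \<in> S_set v" "C \<subseteq> S_level v 0" "C \<noteq> {}" for a C
  proof -
    have "nbrs Sp a \<inter> C = {}"
      using that S_nonzero by (auto simp: nbrs_Sp level_0 sympl_form_commute[of a])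
    then show ?thesis
      using that by (simp add: card_eq_0_iff)
  qed
  have all: "2 * card (nbrs Sp a \<inter> S_level v 4) \<noteq> card (S_level v 4)"
    if "a \<in> S_set v" "S_level v 4 \<noteq> {}" for a
  proof -
    have "nbrs Sp a \<inter> S_level v 4 = S_level v 4"
      using that S_nonzero by (auto simp: nbrs_Sp level_4 sympl_form_commute[of a])
    then show ?thesis
      using that by (simp add: card_eq_0_iff)
  qed
  show ?thesis (is "GM_flip Sp ?\<C> _ x y \<longleftrightarrow> ?rhs")
  proof
    assume "GM_flip Sp ?\<C> (S_set v) x y"
    then obtain C where C: "x \<in> S_set v" "C \<in> ?\<C>" "y \<in> C" "2 * card (nbrs Sp x \<inter> C) = card C"
      unfolding GM_flip_def by blast
    from C(2) consider "C \<subseteq> S_level v 0" | "C = S_level v 2" | "C = S_level v 4"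
      using T_subset_level_0 by blast
    then show ?rhs
    proof cases
      case 1
      then show ?thesis
        using none[OF C(1), of C] C(3,4) by blast
    next
      case 2
      then show ?thesis
        using C by blast
    next
      case 3
      then show ?thesis
        using all[OF C(1)] C(3,4) by blast
    qed
  next
    assume ?rhs
    moreover from this have "S_level v 2 \<in> ?\<C>"
      by blast
    ultimately show "GM_flip Sp ?\<C> (S_set v) x y"
      using half_of_level_2 unfolding GM_flip_def by blast
  qed
qed

lemma flip_of_cell_complement:
  "GM_flip Sp {S_set v} (pverts Sp - S_set v) x y \<longleftrightarrow> y \<in> S_set v \<and> x \<in> S_level v 2"
proof -
  have "x \<notin> S_set v" if "x \<in> S_level v 2"
  proof
    assume "x \<in> S_set v"
    then have "x \<in> S_level v 0"
      using S_subset_level_0 by blast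
    with that have "(2 :: nat) = 0"
      by (rule level_unique)
    then show False
      by simp
  qed
  moreover have "2 * card (nbrs Sp x \<inter> S_set v) = card (S_set v) \<longleftrightarrow> x \<in> S_level v 2"
    if "x \<in> pverts Sp"
  proof -
    have "x \<noteq> 0"
      using that by (simp add: Sp_def)
    have "2 * card (nbrs Sp x \<inter> S_set v) = card (S_set v) \<longleftrightarrow> card (nbrs Sp x \<inter> S_set v) = 2"
      unfolding card_S by linarith
    also have "\<dots> \<longleftrightarrow> x \<in> S_level v 2"
      unfolding card_nbrs_S[OF \<open>x \<noteq> 0\<close>] S_level_def using that by blast
    finally show ?thesis .
  qed
  moreover have "S_level v 2 \<subseteq> pverts Sp"
    unfolding S_level_def by blast
  ultimately show ?thesis
    unfolding GM_flip_def by blast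
qed

lemma Sp_switched_eq: "Sp_switched v = GM_switch Sp {S_set v} (pverts Sp - S_set v)"
  by (simp add: Sp_switched_def GM_switch_def flip_of_cell_S flip_of_cell_complement
      disj_commute)

lemma GM_partition_complement: "GM_partition Sp {S_set v} (pverts Sp - S_set v)"
proof -
  have "S_set v \<noteq> {}"
    using card_S by auto
  (* v 1 + v 2 is a vertex outside S, so the cell V - S is nonempty: its form with a common
     neighbour of S is 1 + 1 = 0, unlike that of a vector of S. *)
  moreover have "v 1 + v 2 \<in> pverts Sp - S_set v"
  proof -
    have "v 1 + v 2 \<in> S_level v 0"
      using T_subset_level_0 by (auto simp: T_set_def)
    moreover obtain u where "\<forall>a\<in>S_set v. sympl_form u a = 1"
      using exists_common_neighbour by blast
    then have "sympl_form u (v 1 + v 2) = 0" "\<forall>a\<in>S_set v. sympl_form u a \<noteq> 0"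
      by (auto simp: sympl_form_add_right S_set_def)
    ultimately show ?thesis
      by (auto simp: Sp_def dest: level_nonzero)
  qed
  ultimately have "partition_on (pverts Sp) (insert (pverts Sp - S_set v) {S_set v})"
    using nonzero by (auto simp: partition_on_def disjoint_def)
  moreover have "pverts Sp - S_set v \<notin> {S_set v}"
    using \<open>S_set v \<noteq> {}\<close> by blast
  moreover have "\<forall>C\<in>{S_set v}. \<forall>C'\<in>{S_set v}. \<forall>x\<in>C. \<forall>y\<in>C.
      card (nbrs Sp x \<inter> C') = card (nbrs Sp y \<inter> C')"
  proof -
    have "nbrs Sp z \<inter> S_set v = {}" if "z \<in> S_set v" for z
      using that orthogonal S_nonzero by (auto simp: nbrs_Sp)
    then show ?thesis
      by simp
  qed
  moreover have "\<forall>x\<in>pverts Sp - S_set v. \<forall>C\<in>{S_set v}.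
      card (nbrs Sp x \<inter> C) = 0 \<or> 2 * card (nbrs Sp x \<inter> C) = card C \<or>
      card (nbrs Sp x \<inter> C) = card C"
  proof (intro ballI)
    fix x C
    assume x: "x \<in> pverts Sp - S_set v" and C: "C \<in> {S_set v}"
    have "x \<noteq> 0"
      using x by (simp add: Sp_def)
    then have "card (nbrs Sp x \<inter> S_set v) \<in> {0, 2, 4}"
      unfolding card_nbrs_S[OF \<open>x \<noteq> 0\<close>] by (intro level_cases)
    moreover have "C = S_set v"
      using C by simp
    ultimately show "card (nbrs Sp x \<inter> C) = 0 \<or> 2 * card (nbrs Sp x \<inter> C) = card C \<or>
        card (nbrs Sp x \<inter> C) = card C"
      using card_S by fastforce
  qed
  ultimately show ?thesis
    unfolding GM_partition_def by (intro conjI)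
qed

end

theorem corollary4p8:
  fixes v :: "nat \<Rightarrow> bit ^ ('n::finite \<times> 2)"
    and S :: "(bit ^ ('n \<times> 2)) set"
  assumes "CARD('n) \<ge> 3"
    and "S \<subseteq> pverts Sp" and "card S = 4" and "S = S_set v"
    and "inj_on v {1..3}" and "vec.independent (v ` {1..3})"
    and "\<forall>i\<in>{1..3}. \<forall>j\<in>{1..3}. sympl_form (v i) (v j) = 0"
    and "v 4 = v 1 + v 2 + v 3"
  shows "GM_partition Sp {S} (pverts Sp - S) \<and>
         digraph_iso (with_proj (Sp_switched v)) (with_proj (GM_switch Sp {S} (pverts Sp - S)))"
proof -
  interpret isotropic_quadruple v
    using assms by unfold_locales auto
  show ?thesis
    using GM_partition_complement
    by (simp add: \<open>S = S_set v\<close> Sp_switched_eq digraph_iso_refl wf_digraph_GM_switch)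
qed

end
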